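(* Let $\gamma\in C^4([0,3h];\mathbb{S}^2)$ and let $p_i=\gamma(ih)$, $i=0,1,2,3$. Assume that the data points and all points generated by the SIDER3 construction lie in a common geodesically convex ball of radius $O(h)$. Let $P_{0123}$ be the SIDER3 interpolant of $p_0,p_1,p_2,p_3$. Then, uniformly for $0\le s\le 3h$, $$d_{\mathbb{S}^2}\!\left(\gamma(s),P_{0123}(s)\right)=O(h^4).$$
   Context: $\mathbb{S}^2=\{x\in\mathbb{R}^3:|x|=1\}$ with the induced Riemannian metric; $d_{\mathbb{S}^2}(y,z)=\arccos(y\cdot z)$. $\operatorname{Exp}_y(v)=\cos|v|\,y+\frac{\sin|v|}{|v|}v$ for $v\in T_y\mathbb{S}^2=\{v\in\mathbb{R}^3:v\cdot y=0\}$ (with $\operatorname{Exp}_y(0)=y$). For $z$ not antipodal to $y$ and $\alpha=\arccos(y\cdot z)$, $\operatorname{Log}_y(z)=\frac{\alpha}{\sin\alpha}(z-(y\cdot z)y)$ (with $\operatorname{Log}_y(y)=0$). For non-antipodal $a,b\in\mathbb{S}^2$ and any real $\lambda$, $\operatorname{SLERP}(a,b,\lambda)=\operatorname{Exp}_a(\lambda\operatorname{Log}_a b)$, equivalently $\frac{\sin((1-\lambda)\alpha)}{\sin\alpha}a+\frac{\sin(\lambda\alpha)}{\sin\alpha}b$ with $\alpha=\arccos(a\cdot b)\in(0,\pi)$. SIDER2 and SIDER3. Write $s=\theta h$. For $i\in\{0,1\}$ put $\tau=(\theta-i)/2$, $d_a=\operatorname{SLERP}(p_{i+2},p_{i+1},2)$,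 $d_b=\operatorname{SLERP}(p_i,p_{i+1},2)$ and $$P_{i,i+1,i+2}(s)=\operatorname{SLERP}\bigl(\operatorname{SLERP}(p_i,d_a,\tau),\operatorname{SLERP}(d_b,p_{i+2},\tau),\tau\bigr),$$ giving the SIDER2 interpolants $P_{012}$ and $P_{123}$. The SIDER3 interpolant is $P_{0123}(s)=\operatorname{SLERP}\bigl(P_{012}(s),P_{123}(s),\frac{\theta}{3}\bigr)$, $0\le\theta\le3$. Conventions: $\gamma$ is a fixed curve and $h\to0^+$; $h$ is small enough that, in the common geodesically convex ball, logarithms are single-valued and geodesics unique. $O(h^4)$ means bounded by $Ch^4$ for all sufficiently small $h$, with $C$ independent of $h$ and $s$. *)

theory Defs
  imports "HOL-Analysis.Analysis" "HOL-Library.Landau_Symbols"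
begin

abbreviation S2 :: "(real^3) set" where
  "S2 \<equiv> sphere 0 1"

definition sph_dist :: "real^3 \<Rightarrow> real^3 \<Rightarrow> real" where
  "sph_dist y z = arccos (y \<bullet> z)"

definition sph_Exp :: "real^3 \<Rightarrow> real^3 \<Rightarrow> real^3" where
  "sph_Exp y v = (if v = 0 then y
     else cos (norm v) *\<^sub>R y + (sin (norm v) / norm v) *\<^sub>R v)"

text \<open>Meaningful only for \<open>y\<close>, \<open>z\<close> on the sphere with \<open>z \<noteq> - y\<close>.
  At the antipode the formula returns \<open>0\<close>, since division by zero yields zero.\<close>

definition sph_Log :: "real^3 \<Rightarrow> real^3 \<Rightarrow> real^3" where
  "sph_Log y z = (if z = y then 0
     else (let \<alpha> = arccos (y \<bullet> z) in (\<alpha> / sin \<alpha>) *\<^sub>R (z - (y \<bullet> z) *\<^sub>R y)))"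

definition slerp :: "real^3 \<Rightarrow> real^3 \<Rightarrow> real \<Rightarrow> real^3" where
  "slerp a b t = sph_Exp a (t *\<^sub>R sph_Log a b)"

text \<open>A sequence of points \<open>p\<close> stands for the data at the parameters \<open>0, h, 2h, 3h\<close>.\<close>

definition extrap_a :: "(nat \<Rightarrow> real^3) \<Rightarrow> nat \<Rightarrow> real^3" where
  "extrap_a p i = slerp (p (i + 2)) (p (i + 1)) 2"

definition extrap_b :: "(nat \<Rightarrow> real^3) \<Rightarrow> nat \<Rightarrow> real^3" where
  "extrap_b p i = slerp (p i) (p (i + 1)) 2"

definition loc_param :: "real \<Rightarrow> nat \<Rightarrow> real \<Rightarrow> real" where
  "loc_param h i s = (s / h - real i) / 2"

definition inner_a :: "real \<Rightarrow> (nat \<Rightarrow> real^3) \<Rightarrow> nat \<Rightarrow> real \<Rightarrow> real^3" where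
  "inner_a h p i s = slerp (p i) (extrap_a p i) (loc_param h i s)"

definition inner_b :: "real \<Rightarrow> (nat \<Rightarrow> real^3) \<Rightarrow> nat \<Rightarrow> real \<Rightarrow> real^3" where
  "inner_b h p i s = slerp (extrap_b p i) (p (i + 2)) (loc_param h i s)"

text \<open>\<open>sider2 h p i\<close> interpolates \<open>p i\<close>, \<open>p (i + 1)\<close>, \<open>p (i + 2)\<close>.\<close>

definition sider2 :: "real \<Rightarrow> (nat \<Rightarrow> real^3) \<Rightarrow> nat \<Rightarrow> real \<Rightarrow> real^3" where
  "sider2 h p i s = slerp (inner_a h p i s) (inner_b h p i s) (loc_param h i s)"

definition sider3 :: "real \<Rightarrow> (nat \<Rightarrow> real^3) \<Rightarrow> real \<Rightarrow> real^3" where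
  "sider3 h p s = slerp (sider2 h p 0 s) (sider2 h p 1 s) ((s / h) / 3)"

definition sider3_points :: "real \<Rightarrow> (nat \<Rightarrow> real^3) \<Rightarrow> (real^3) set" where
  "sider3_points h p =
     p ` {0..3}
     \<union> (\<Union>i\<in>{0, 1}. {extrap_a p i, extrap_b p i})
     \<union> (\<Union>s\<in>{0..3*h}. (\<Union>i\<in>{0, 1}. {inner_a h p i s, inner_b h p i s, sider2 h p i s})
                     \<union> {sider3 h p s})"

definition geodesic_ball :: "real^3 \<Rightarrow> real \<Rightarrow> (real^3) set" where
  "geodesic_ball c r = {z \<in> S2. sph_dist c z < r}"

text \<open>Minimizing geodesics, parametrized proportionally to arc length on the unit interval.\<close>

definition minimizing_geodesic :: "(real \<Rightarrow> real^3) \<Rightarrow> real^3 \<Rightarrow> real^3 \<Rightarrow> bool" where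
  "minimizing_geodesic g a b \<longleftrightarrow> g 0 = a \<and> g 1 = b \<and> g ` {0..1} \<subseteq> S2 \<and>
     (\<forall>t\<in>{0..1}. \<forall>u\<in>{0..1}. sph_dist (g t) (g u) = \<bar>t - u\<bar> * sph_dist a b)"

definition geodesically_convex :: "(real^3) set \<Rightarrow> bool" where
  "geodesically_convex U \<longleftrightarrow> U \<subseteq> S2 \<and>
     (\<forall>a\<in>U. \<forall>b\<in>U. \<exists>g. minimizing_geodesic g a b \<and> g ` {0..1} \<subseteq> U \<and>
        (\<forall>g'. minimizing_geodesic g' a b \<longrightarrow> (\<forall>t\<in>{0..1}. g' t = g t)))"

text \<open>Class \<open>C\<^sup>k\<close> on a nondegenerate interval \<open>S\<close>, with one-sided derivatives at the
  endpoints that belong to \<open>S\<close>; \<open>D j\<close> is the \<open>j\<close>-th derivative.\<close>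

definition Ck_on :: "nat \<Rightarrow> (real \<Rightarrow> 'a::real_normed_vector) \<Rightarrow> real set \<Rightarrow> bool" where
  "Ck_on k f S \<longleftrightarrow> (\<exists>D. (\<forall>t\<in>S. D 0 t = f t) \<and>
     (\<forall>j<k. \<forall>t\<in>S. (D j has_vector_derivative D (Suc j) t) (at t within S)) \<and>
     (\<forall>j\<le>k. continuous_on S (D j)))"

end

(* Let N = gamma 0 and let V be a unit tangent vector with gamma' 0 = k V.  In cylindrical
   coordinates around the great circle through N and V, a point at distance O(h) from N and
   O(h^2) from that circle is cos u N + sin u V + w + O(h^4) with u = O(h) and w = O(h^2)
   orthogonal to N and V.  On such points SLERP is affine interpolation of (u, w) up to O(h^4):
   along the circle it is exact, and the curvature terms always carry a factor w h^2.  By Taylor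
   expansion, gamma has coordinates that are cubic polynomials up to O(h^4), and on cubic
   polynomials the flat SIDER3 scheme is Neville's algorithm, which reproduces them exactly. *)
theory Submission
  imports Defs
begin

text \<open>Distances are accessible only through their cosines, and \<open>arccos\<close> is not
  Lipschitz at 1: an error of order h^4 in \<open>a \<bullet> b\<close> can cost h^2 in the distance
  when the points are close. The square of the distance, however, is then still correct to O(h^4),
  and to this order the SLERP weights depend only on that square. Hence they are expanded in the
  squared distance, which also removes the singular quotient at coinciding points. The circle has to
  be tangent to \<gamma> at the start: another direction would leave displacements w of order h, and
  curvature terms of order h^3. Coordinates are kept as a relation with explicit constants instead
  of O-terms, because one bound must hold for all s and all small h. Each SLERP turns a constant
  \<open>M\<close> into \<open>slerp_const M\<close>, and SIDER3 nests four of them: extrapolation,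
  inner curves, SIDER2, final blend.\<close>

subsection \<open>Expansion of SLERP for small angles\<close>

text \<open>The expansion \<open>sin (t * x) / sin x = slerp_coeff t (x\<^sup>2) + O(x^4)\<close>.\<close>

definition slerp_coeff :: "real \<Rightarrow> real \<Rightarrow> real" where
  "slerp_coeff t y = t + t * (1 - t\<^sup>2) / 6 * y"

section \<open>Numerical bounds for sine, cosine and the SLERP weights\<close>

lemma sin_cubic_approx: "\<bar>sin x - (x - x ^ 3 / 6)\<bar> \<le> \<bar>x\<bar> ^ 5 / 120" for x :: real
proof -
  have "(\<Sum>m<5. sin_coeff m * x ^ m) = x - x ^ 3 / 6"
    by (simp add: lessThan_nat_numeral lessThan_Suc sin_coeff_def fact_numeral)
  moreover have "inverse (fact 5) = (1 / 120 :: real)" by (simp add: fact_numeral)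
  ultimately show ?thesis using Maclaurin_sin_bound[of x 5] by (metis mult.commute mult_1 times_divide_eq_right)
qed

lemma sin_linear_approx: "\<bar>sin x - x\<bar> \<le> \<bar>x\<bar> ^ 3 / 6" for x :: real
proof -
  have "(\<Sum>m<3. sin_coeff m * x ^ m) = x"
    by (simp add: lessThan_nat_numeral lessThan_Suc sin_coeff_def)
  moreover have "inverse (fact 3) = (1 / 6 :: real)" by (simp add: fact_numeral)
  ultimately show ?thesis using Maclaurin_sin_bound[of x 3] by (metis mult.commute mult_1 times_divide_eq_right)
qed

text \<open>With y = x/2, the half-angle formula turns the error into twice the difference of the
  squares of y and sin y, so the bound for sin y - y suffices.\<close>

lemma cos_quadratic_approx: "\<bar>cos x - (1 - x\<^sup>2 / 2)\<bar> \<le> x ^ 4 / 24" for x :: real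
proof -
  define y where "y = x / 2"
  have x: "x = 2 * y" by (simp add: y_def)
  have "cos x - (1 - x\<^sup>2 / 2) = - 2 * ((sin y - y) * (sin y + y))"
    unfolding x cos_double_sin by (simp add: power2_eq_square algebra_simps)
  moreover have "\<bar>(sin y - y) * (sin y + y)\<bar> \<le> (\<bar>y\<bar> ^ 3 / 6) * (2 * \<bar>y\<bar>)"
    unfolding abs_mult
    by (intro mult_mono sin_linear_approx) (use abs_sin_x_le_abs_x[of y] in auto)
  moreover have "(\<bar>y\<bar> ^ 3 / 6) * (2 * \<bar>y\<bar>) = y ^ 4 / 3"
    by (simp add: eval_nat_numeral flip: abs_mult)
  ultimately show ?thesis
    unfolding x by (simp add: abs_mult power_mult_distrib)
qed

lemma sin_lower_bound:
  fixes x :: real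
  assumes "0 \<le> x" "x \<le> 1"
  shows "5 / 6 * x \<le> sin x"
proof -
  have "x ^ 3 \<le> x ^ 1" by (intro power_decreasing) (use assms in auto)
  moreover have "\<bar>sin x - x\<bar> \<le> x ^ 3 / 6" using sin_linear_approx[of x] assms by simp
  ultimately show ?thesis unfolding abs_le_iff power_one_right by linarith
qed

text \<open>The numerator agrees with \<open>slerp_coeff\<close> times sin x up to order x^5, and
  dividing by sin x costs one power. The range of \<open>t\<close> is 3 because a SLERP with
  parameter at most 2 in modulus also has the weight belonging to 1 - t.\<close>

lemma slerp_coeff_approx:
  assumes x: "0 < x" "x \<le> 1" and t: "\<bar>t\<bar> \<le> 3"
  shows "\<bar>sin (t * x) / sin x - slerp_coeff t (x\<^sup>2)\<bar> \<le> 6 * x ^ 4"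
proof -
  let ?Q = "slerp_coeff t (x\<^sup>2)"
  define r1 where "r1 = sin (t * x) - (t * x - (t * x) ^ 3 / 6)"
  define r2 where "r2 = sin x - (x - x ^ 3 / 6)"
  have t2: "t\<^sup>2 \<le> 9" using power_mono[OF t, of 2] by simp
  have t5: "\<bar>t\<bar> ^ 5 \<le> 243" using power_mono[OF t, of 5] by simp
  have "\<bar>r1\<bar> \<le> \<bar>t * x\<bar> ^ 5 / 120" unfolding r1_def by (rule sin_cubic_approx)
  also have "\<dots> \<le> 243 * x ^ 5 / 120"
    using mult_right_mono[OF t5, of "x ^ 5"] x by (simp add: abs_mult power_mult_distrib)
  finally have r1: "\<bar>r1\<bar> \<le> 243 * x ^ 5 / 120" .
  have r2: "\<bar>r2\<bar> \<le> x ^ 5 / 120" unfolding r2_def using sin_cubic_approx[of x] x by simp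
  have "\<bar>1 - t\<^sup>2\<bar> \<le> 8" using t2 zero_le_power2[of t] unfolding abs_le_iff by linarith
  then have c: "\<bar>t * (1 - t\<^sup>2)\<bar> \<le> 24"
    using mult_mono[of "\<bar>t\<bar>" 3 "\<bar>1 - t\<^sup>2\<bar>" 8] t by (simp add: abs_mult)
  have "\<bar>t * (1 - t\<^sup>2) / 6 * x\<^sup>2\<bar> \<le> 4 * 1"
    unfolding abs_mult by (rule mult_mono) (use c x in \<open>auto simp: abs_mult power_le_one\<close>)
  then have Q: "\<bar>?Q\<bar> \<le> 7" unfolding slerp_coeff_def using t by linarith
  \<comment> \<open>The terms in x and x^3 cancel; this is what determines the coefficient t(1 -
    t^2)/6 in \<open>slerp_coeff\<close>.\<close>
  have "sin (t * x) - ?Q * sin x = r1 + t * (1 - t\<^sup>2) / 36 * x ^ 5 - ?Q * r2"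
    unfolding r1_def r2_def slerp_coeff_def by (simp add: field_simps eval_nat_numeral)
  moreover have "\<bar>t * (1 - t\<^sup>2) / 36 * x ^ 5\<bar> \<le> 24 / 36 * x ^ 5"
    using mult_right_mono[OF c, of "x ^ 5 / 36"] x by (simp add: abs_mult)
  moreover have "\<bar>?Q * r2\<bar> \<le> 7 * (x ^ 5 / 120)"
    unfolding abs_mult by (rule mult_mono) (use Q r2 in auto)
  moreover have "0 < x ^ 5" using x by simp
  ultimately have num: "\<bar>sin (t * x) - ?Q * sin x\<bar> \<le> 3 * x ^ 5" using r1 by linarith
  have sx: "x / 2 \<le> sin x" using sin_lower_bound[of x] x by simp
  then have sx0: "0 < sin x" using x by linarith
  have "\<bar>sin (t * x) / sin x - ?Q\<bar> = \<bar>sin (t * x) - ?Q * sin x\<bar> / sin x"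
  proof -
    have "sin (t * x) / sin x - ?Q = (sin (t * x) - ?Q * sin x) / sin x"
      using sx0 by (simp add: field_simps)
    then show ?thesis using sx0 by (simp add: abs_divide)
  qed
  also have "\<dots> \<le> 3 * x ^ 5 / (x / 2)" using num sx x by (intro frac_le) auto
  also have "\<dots> = 6 * x ^ 4" using x by (simp add: eval_nat_numeral)
  finally show ?thesis .
qed

text \<open>The slope in y is t(1 - t^2)/6, at most 24/6 = 4 in modulus. The three forms serve to
  exchange one squared angle for another, to reduce a weight to its flat value, and to pass on
  errors already present in the endpoints.\<close>

lemma slerp_coeff_bound:
  assumes "\<bar>t\<bar> \<le> 3"
  shows "\<bar>slerp_coeff t y - slerp_coeff t z\<bar> \<le> 4 * \<bar>y - z\<bar>"
    and "\<bar>slerp_coeff t y - t\<bar> \<le> 4 * \<bar>y\<bar>"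
    and "\<bar>y\<bar> \<le> 1 \<Longrightarrow> \<bar>slerp_coeff t y\<bar> \<le> 7"
proof -
  have t2: "t\<^sup>2 \<le> 9" using power_mono[OF assms, of 2] by simp
  have "\<bar>1 - t\<^sup>2\<bar> \<le> 8" using t2 zero_le_power2[of t] unfolding abs_le_iff by linarith
  then have c: "\<bar>t * (1 - t\<^sup>2)\<bar> \<le> 24"
    using mult_mono[of "\<bar>t\<bar>" 3 "\<bar>1 - t\<^sup>2\<bar>" 8] assms by (simp add: abs_mult)
  have *: "\<bar>t * (1 - t\<^sup>2) / 6 * y\<bar> \<le> 4 * \<bar>y\<bar>" for y
    using mult_right_mono[OF c, of "\<bar>y\<bar> / 6"] by (simp add: abs_mult)
  have "slerp_coeff t y - slerp_coeff t z = t * (1 - t\<^sup>2) / 6 * (y - z)"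
    by (simp add: slerp_coeff_def field_simps)
  then show "\<bar>slerp_coeff t y - slerp_coeff t z\<bar> \<le> 4 * \<bar>y - z\<bar>" using *[of "y - z"] by simp
  show **: "\<bar>slerp_coeff t y - t\<bar> \<le> 4 * \<bar>y\<bar>" using *[of y] by (simp add: slerp_coeff_def)
  show "\<bar>slerp_coeff t y\<bar> \<le> 7" if "\<bar>y\<bar> \<le> 1" using ** that assms by linarith
qed

section \<open>Chordal and angular distance, and the closed form of SLERP\<close>

lemma sphere_chord:
  assumes "a \<in> S2" "b \<in> S2"
  shows "norm (a - b) ^ 2 = 2 - 2 * (a \<bullet> b)" and "\<bar>a \<bullet> b\<bar> \<le> 1"
    and "cos (sph_dist a b) = a \<bullet> b" and "0 \<le> sph_dist a b" and "sph_dist a b \<le> pi"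
proof -
  have [simp]: "norm a = 1" "norm b = 1" using assms by auto
  then have [simp]: "a \<bullet> a = 1" "b \<bullet> b = 1" by (simp_all flip: power2_norm_eq_inner)
  show *: "\<bar>a \<bullet> b\<bar> \<le> 1" using Cauchy_Schwarz_ineq2[of a b] by simp
  show "norm (a - b) ^ 2 = 2 - 2 * (a \<bullet> b)"
    by (simp add: power2_norm_eq_inner inner_diff inner_commute)
  show "cos (sph_dist a b) = a \<bullet> b" "0 \<le> sph_dist a b" "sph_dist a b \<le> pi" using *
    by (auto simp: sph_dist_def abs_le_iff cos_arccos_abs arccos_lbound arccos_ubound)
qed

text \<open>The chord is twice the sine of half the angle. For half-angles above 1, monotonicity
  gives 3 sin y >= 3 sin 1 >= 5/2 > pi/2, so the bound reaches up to antipodes.\<close>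

lemma sph_dist_le_chord:
  assumes "a \<in> S2" "b \<in> S2"
  shows "sph_dist a b \<le> 3 * norm (a - b)"
proof -
  define y where "y = sph_dist a b / 2"
  have y: "0 \<le> y" "y \<le> pi / 2" using sphere_chord(4,5)[OF assms] by (auto simp: y_def)
  have "y \<le> 3 * sin y"
  proof (cases "y \<le> 1")
    case True
    then show ?thesis using sin_lower_bound[of y] y by linarith
  next
    case False
    have "sin 1 \<le> sin y" using y False by (intro sin_monotone_2pi_le) (auto intro: order_trans[of _ 0])
    then show ?thesis using sin_lower_bound[of 1] y pi_half_less_two by simp
  qed
  moreover have "norm (a - b) ^ 2 = (2 * sin y) ^ 2"
    using sphere_chord(1,3)[OF assms] cos_double_sin[of y] by (simp add: y_def power_mult_distrib)
  moreover have "0 \<le> sin y" using y by (intro sin_ge_zero) auto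
  ultimately show ?thesis using power2_eq_imp_eq[of "norm (a - b)" "2 * sin y"] by (simp add: y_def)
qed

text \<open>\<open>sph_Log a b\<close> is orthogonal to \<open>a\<close> even where it returns a
  default value, so the exponential has norm 1 for every pair.\<close>

lemma slerp_in_sphere:
  assumes "a \<in> S2" "b \<in> S2"
  shows "slerp a b t \<in> S2"
proof -
  have a: "a \<bullet> a = 1" using assms by (simp flip: power2_norm_eq_inner)
  define v where "v = t *\<^sub>R sph_Log a b"
  have "a \<bullet> v = 0" by (simp add: v_def sph_Log_def Let_def inner_diff a)
  then have "norm (sph_Exp a v) ^ 2 = 1" if "v \<noteq> 0"
    using that a
    by (simp add: sph_Exp_def power2_norm_eq_inner inner_add inner_commute[of v a])
       (simp add: field_simps flip: power2_norm_eq_inner power2_eq_square)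
  moreover have "norm (sph_Exp a v) = 1" if "v = 0" using that assms by (simp add: sph_Exp_def)
  ultimately have "norm (sph_Exp a v) = 1"
    using power2_eq_imp_eq[of "norm (sph_Exp a v)" 1] by fastforce
  then show ?thesis by (simp add: slerp_def v_def)
qed

text \<open>The component of \<open>b\<close> orthogonal to \<open>a\<close> has norm sin x, so the
  exponential moves in the plane of \<open>a\<close> and \<open>b\<close>; the subtraction formula
  for sine then collects the coefficient of \<open>a\<close>.\<close>

lemma slerp_eq:
  assumes ab: "a \<in> S2" "b \<in> S2" and "a \<noteq> b" "sph_dist a b < pi"
  shows "slerp a b t =
    (sin ((1 - t) * sph_dist a b) / sin (sph_dist a b)) *\<^sub>R a
    + (sin (t * sph_dist a b) / sin (sph_dist a b)) *\<^sub>R b"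
proof -
  define x where "x = sph_dist a b"
  have a: "a \<bullet> a = 1" "b \<bullet> b = 1" using ab by (simp_all flip: power2_norm_eq_inner)
  have cx: "cos x = a \<bullet> b" using sphere_chord(3)[OF ab] by (simp add: x_def)
  have "norm (a - b) ^ 2 \<noteq> 0" using \<open>a \<noteq> b\<close> by simp
  then have "cos x \<noteq> 1" using sphere_chord(1)[OF ab] cx by auto
  then have "x \<noteq> 0" by auto
  then have x0: "0 < x" "x < pi" using sphere_chord(4)[OF ab] assms(4) by (auto simp: x_def)
  then have sx: "0 < sin x" by (rule sin_gt_zero)
  define w where "w = b - (a \<bullet> b) *\<^sub>R a"
  have "norm w ^ 2 = 1 - (cos x) ^ 2"
    unfolding w_def power2_norm_eq_inner
    by (simp add: inner_diff a inner_commute[of b a] cx power2_eq_square)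
  also have "\<dots> = (sin x) ^ 2" by (simp add: sin_squared_eq)
  finally have nw: "norm w = sin x" using sx power2_eq_imp_eq[of "norm w" "sin x"] by simp
  have L: "sph_Log a b = (x / sin x) *\<^sub>R w"
    using \<open>a \<noteq> b\<close> by (simp add: sph_Log_def x_def sph_dist_def w_def Let_def)
  have nL: "norm (t *\<^sub>R sph_Log a b) = \<bar>t\<bar> * x"
    using sx x0 by (simp add: L nw abs_mult)
  have E: "slerp a b t = cos (t * x) *\<^sub>R a + (sin (t * x) / sin x) *\<^sub>R w"
  proof (cases "t = 0")
    case True
    then show ?thesis by (simp add: slerp_def sph_Exp_def)
  next
    case False
    then have "t *\<^sub>R sph_Log a b \<noteq> 0" using sx x0 nL by (metis mult_eq_0_iff abs_eq_0 norm_zero less_irrefl)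
    then have "slerp a b t = cos (\<bar>t\<bar> * x) *\<^sub>R a + (sin (\<bar>t\<bar> * x) / (\<bar>t\<bar> * x)) *\<^sub>R (t *\<^sub>R sph_Log a b)"
      unfolding slerp_def sph_Exp_def by (simp only: nL if_False)
    \<comment> \<open>Cosine and sin y / y are even, so the modulus of \<open>t\<close> can be
      replaced by \<open>t\<close>.\<close>
    also have "\<dots> = cos (t * x) *\<^sub>R a + (sin (t * x) / sin x) *\<^sub>R w"
      using False x0 by (auto simp: L abs_if)
    finally show ?thesis .
  qed
  have "sin ((1 - t) * x) = sin x * cos (t * x) - cos x * sin (t * x)"
    by (simp add: left_diff_distrib sin_diff)
  then have "sin ((1 - t) * x) / sin x = cos (t * x) - sin (t * x) / sin x * (a \<bullet> b)"
    using sx by (simp add: field_simps cx)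
  then show ?thesis
    unfolding E w_def x_def[symmetric] by (simp only: scaleR_diff_left scaleR_diff_right scaleR_scaleR) simp
qed

lemma slerp_approx:
  assumes ab: "a \<in> S2" "b \<in> S2" and d: "sph_dist a b \<le> 1" and t: "\<bar>t\<bar> \<le> 2"
  defines "y \<equiv> (sph_dist a b)\<^sup>2"
  shows "norm (slerp a b t - (slerp_coeff (1 - t) y *\<^sub>R a + slerp_coeff t y *\<^sub>R b)) \<le> 12 * (sph_dist a b) ^ 4"
proof (cases "a = b")
  case True
  moreover have "a \<bullet> a = 1" using ab by (simp flip: power2_norm_eq_inner)
  ultimately have "sph_dist a b = 0" by (simp add: sph_dist_def)
  \<comment> \<open>The closed form degenerates here, but at y = 0 the weights are 1 - t and t, so
    both expressions equal \<open>a\<close>.\<close>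
  then show ?thesis using True
    by (simp add: y_def slerp_coeff_def slerp_def sph_Log_def sph_Exp_def scaleR_left_distrib[symmetric])
next
  case False
  define x where "x = sph_dist a b"
  have cx: "cos x = a \<bullet> b" using sphere_chord(3)[OF ab] by (simp add: x_def)
  have "norm (a - b) ^ 2 \<noteq> 0" using \<open>a \<noteq> b\<close> by simp
  then have "cos x \<noteq> 1" using sphere_chord(1)[OF ab] cx by auto
  then have "x \<noteq> 0" by auto
  then have x0: "0 < x" "x \<le> 1" using sphere_chord(4)[OF ab] d by (auto simp: x_def)
  have [simp]: "norm a = 1" "norm b = 1" using ab by auto
  have "sph_dist a b < pi" using d pi_gt3 by linarith
  then have "slerp a b t - (slerp_coeff (1 - t) y *\<^sub>R a + slerp_coeff t y *\<^sub>R b)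
     = (sin ((1 - t) * x) / sin x - slerp_coeff (1 - t) y) *\<^sub>R a
     + (sin (t * x) / sin x - slerp_coeff t y) *\<^sub>R b"
    using slerp_eq[OF ab False] by (simp add: x_def algebra_simps)
  also have "norm \<dots> \<le> \<bar>sin ((1 - t) * x) / sin x - slerp_coeff (1 - t) y\<bar> + \<bar>sin (t * x) / sin x - slerp_coeff t y\<bar>"
    by (rule order_trans[OF norm_triangle_ineq]) simp
  also have "\<dots> \<le> 6 * x ^ 4 + 6 * x ^ 4"
    unfolding y_def x_def[symmetric]
    by (intro add_mono slerp_coeff_approx x0) (use t in auto)
  finally show ?thesis by (simp add: x_def)
qed

subsection \<open>The flat scheme\<close>

text \<open>Polymorphic, since the angle u is a real and the displacement w a vector;
  \<open>t\<close> may lie outside the unit interval.\<close>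

definition lerp :: "'a::real_vector \<Rightarrow> 'a \<Rightarrow> real \<Rightarrow> 'a" where
  "lerp a b t = (1 - t) *\<^sub>R a + t *\<^sub>R b"

text \<open>Expanded, the weights of the three points are (1 - t)(1 - 2t), 4t(1 - t) and t(2t - 1):
  the quadratic Lagrange basis for the nodes 0, 1/2, 1.\<close>

definition flat_sider2 :: "(nat \<Rightarrow> 'a::real_vector) \<Rightarrow> nat \<Rightarrow> real \<Rightarrow> 'a" where
  "flat_sider2 p i t = lerp (lerp (p i) (lerp (p (i + 2)) (p (i + 1)) 2) t)
     (lerp (lerp (p i) (p (i + 1)) 2) (p (i + 2)) t) t"

definition flat_sider3 :: "(nat \<Rightarrow> 'a::real_vector) \<Rightarrow> real \<Rightarrow> 'a" where
  "flat_sider3 p \<theta> = lerp (flat_sider2 p 0 (\<theta> / 2)) (flat_sider2 p 1 ((\<theta> - 1) / 2)) (\<theta> / 3)"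

lemma lerp_combination:
  "lerp (x1 *\<^sub>R c1 + x2 *\<^sub>R c2 + x3 *\<^sub>R c3) (y1 *\<^sub>R c1 + y2 *\<^sub>R c2 + y3 *\<^sub>R c3) t
    = lerp x1 y1 t *\<^sub>R c1 + lerp x2 y2 t *\<^sub>R c2 + lerp x3 y3 t *\<^sub>R c3"
  by (simp add: lerp_def algebra_simps)

text \<open>Linearity in the data reduces the reproduction of vector-valued cubics to scalar
  identities for single monomials.\<close>

lemma flat_sider3_combination:
  "flat_sider3 (\<lambda>i. x1 i *\<^sub>R c1 + x2 i *\<^sub>R c2 + x3 i *\<^sub>R c3) t
    = flat_sider3 x1 t *\<^sub>R c1 + flat_sider3 x2 t *\<^sub>R c2 + flat_sider3 x3 t *\<^sub>R c3"
  unfolding flat_sider3_def flat_sider2_def lerp_combination ..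

text \<open>The polynomial has no constant term because the coordinates are centred at the start of
  the curve, where u and w vanish.\<close>

lemma flat_sider3_cubic:
  fixes c1 c2 c3 :: "'a::real_vector"
  assumes "h \<noteq> 0"
  defines "p \<equiv> \<lambda>s. s *\<^sub>R c1 + s\<^sup>2 *\<^sub>R c2 + s ^ 3 *\<^sub>R c3"
  shows "flat_sider3 (\<lambda>i. p (real i * h)) (s / h) = p s"
proof -
  define t where "t = s / h"
  have s: "s = t * h" using assms by (simp add: t_def)
  have "flat_sider3 (\<lambda>i. real i * h) t = t * h"
    by (simp add: flat_sider3_def flat_sider2_def lerp_def field_simps)
  moreover have "flat_sider3 (\<lambda>i. (real i * h)\<^sup>2) t = (t * h)\<^sup>2"
    by (simp add: flat_sider3_def flat_sider2_def lerp_def field_simps power2_eq_square)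
  moreover have "flat_sider3 (\<lambda>i. (real i * h) ^ 3) t = (t * h) ^ 3"
    by (simp add: flat_sider3_def flat_sider2_def lerp_def field_simps power3_eq_cube)
  ultimately show ?thesis
    unfolding p_def flat_sider3_combination t_def[symmetric] by (simp add: s)
qed

text \<open>Rounds up the error sum 265024 M^4 + 32 M^3 + 14 M of one SLERP step for M >= 1. The
  fourth power comes from angles bounded by a multiple of M h.\<close>

definition slerp_const :: "real \<Rightarrow> real" where
  "slerp_const M = 300000 * M ^ 4"

lemma slerp_const_ge:
  assumes "1 \<le> M"
  shows "M \<le> slerp_const M"
  using power_increasing[of 1 4 M] assms by (simp add: slerp_const_def)

subsection \<open>Coordinates around a great circle\<close>

locale frame =
  fixes N V :: "real^3"
  assumes norm_N [simp]: "norm N = 1" and norm_V [simp]: "norm V = 1" and orth [simp]: "N \<bullet> V = 0"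
begin

definition circ :: "real \<Rightarrow> real^3" where
  "circ u = cos u *\<^sub>R N + sin u *\<^sub>R V"

text \<open>A relation, since u and w are meant only modulo the h^4 remainder: no exact coordinates
  of \<open>a\<close> are ever computed. One \<open>M\<close> for the three scales h, h^2, h^4 makes
  a SLERP step a single map of constants.\<close>

definition near :: "real \<Rightarrow> real \<Rightarrow> real^3 \<Rightarrow> real \<Rightarrow> real^3 \<Rightarrow> bool" where
  "near M h a u w \<longleftrightarrow> a \<in> S2 \<and> N \<bullet> w = 0 \<and> V \<bullet> w = 0 \<and>
     \<bar>u\<bar> \<le> M * h \<and> norm w \<le> M * h\<^sup>2 \<and> norm (a - (circ u + w)) \<le> M * h ^ 4"

lemma inner_self [simp]: "N \<bullet> N = 1" "V \<bullet> V = 1" "V \<bullet> N = 0"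
  using norm_N norm_V orth by (simp_all add: inner_commute flip: power2_norm_eq_inner)

lemma circ_inner_circ: "circ u \<bullet> circ v = cos (v - u)"
  by (simp add: circ_def inner_add cos_diff algebra_simps)

lemma norm_circ [simp]: "norm (circ u) = 1"
  using circ_inner_circ[of u u] by (simp add: norm_eq_sqrt_inner)

text \<open>SLERP along a great circle is exact in the angle; multiplying by \<open>sin d\<close>
  keeps the identity free of division and valid for \<open>d\<close> of either sign.\<close>

lemma circ_interpolation:
  "sin ((1 - t) * d) *\<^sub>R circ u + sin (t * d) *\<^sub>R circ (u + d) = sin d *\<^sub>R circ (u + t * d)"
proof -
  have "sin ((1 - t) * d) = sin d * cos (t * d) - cos d * sin (t * d)"
    by (simp add: left_diff_distrib sin_diff)
  then have *:
    "sin ((1 - t) * d) * cos u + sin (t * d) * cos (u + d) = sin d * cos (u + t * d)"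
    "sin ((1 - t) * d) * sin u + sin (t * d) * sin (u + d) = sin d * sin (u + t * d)"
    unfolding cos_add sin_add by algebra+
  have "sin ((1 - t) * d) *\<^sub>R circ u + sin (t * d) *\<^sub>R circ (u + d)
    = (sin ((1 - t) * d) * cos u + sin (t * d) * cos (u + d)) *\<^sub>R N
    + (sin ((1 - t) * d) * sin u + sin (t * d) * sin (u + d)) *\<^sub>R V"
    unfolding circ_def scaleR_add_right scaleR_add_left scaleR_scaleR by (simp only: add_ac)
  also have "\<dots> = sin d *\<^sub>R circ (u + t * d)"
    unfolding * circ_def scaleR_add_right scaleR_scaleR ..
  finally show ?thesis .
qed

lemma circ_approx:
  assumes d: "\<bar>d\<bar> \<le> 1" and t: "\<bar>t\<bar> \<le> 2"
  shows "norm (slerp_coeff (1 - t) (d\<^sup>2) *\<^sub>R circ u + slerp_coeff t (d\<^sup>2) *\<^sub>R circ (u + d) - circ (u + t * d))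
    \<le> 12 * d ^ 4"
proof (cases "d = 0")
  case True
  then show ?thesis by (simp add: slerp_coeff_def flip: scaleR_add_left)
next
  case False
  have *: "\<bar>slerp_coeff r (d\<^sup>2) - sin (r * d) / sin d\<bar> \<le> 6 * d ^ 4" if "\<bar>r\<bar> \<le> 3" for r
  proof -
    \<comment> \<open>The quotient is even in \<open>d\<close>, and \<open>d\<close> is a signed
      angle, unlike the distances in \<open>slerp_coeff_approx\<close>.\<close>
    have "sin (r * \<bar>d\<bar>) / sin \<bar>d\<bar> = sin (r * d) / sin d" by (simp add: abs_if)
    then show ?thesis
      using slerp_coeff_approx[of "\<bar>d\<bar>" r] that d False by (simp add: abs_minus_commute)
  qed
  have "sin d \<noteq> 0"
    using sin_lower_bound[of "\<bar>d\<bar>"] d False by (auto simp: abs_if split: if_splits)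
  then have "circ (u + t * d) = (sin ((1 - t) * d) / sin d) *\<^sub>R circ u + (sin (t * d) / sin d) *\<^sub>R circ (u + d)"
    using arg_cong[OF circ_interpolation[of t d u], of "\<lambda>x. inverse (sin d) *\<^sub>R x"]
    by (simp add: scaleR_add_right field_simps)
  then have "slerp_coeff (1 - t) (d\<^sup>2) *\<^sub>R circ u + slerp_coeff t (d\<^sup>2) *\<^sub>R circ (u + d) - circ (u + t * d)
    = (slerp_coeff (1 - t) (d\<^sup>2) - sin ((1 - t) * d) / sin d) *\<^sub>R circ u
    + (slerp_coeff t (d\<^sup>2) - sin (t * d) / sin d) *\<^sub>R circ (u + d)"
    by (simp add: algebra_simps)
  also have "norm \<dots> \<le> \<bar>slerp_coeff (1 - t) (d\<^sup>2) - sin ((1 - t) * d) / sin d\<bar>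
    + \<bar>slerp_coeff t (d\<^sup>2) - sin (t * d) / sin d\<bar>"
    by (rule order_trans[OF norm_triangle_ineq]) simp
  also have "\<dots> \<le> 6 * d ^ 4 + 6 * d ^ 4"
    by (intro add_mono *) (use t in auto)
  finally show ?thesis by simp
qed

text \<open>Orthogonality of \<open>w\<close>, \<open>z\<close> to the plane of the circle removes the cross terms
  of order \<open>h^3\<close> from \<open>a \<bullet> b\<close>.\<close>

lemma near_sph_dist:
  assumes a: "near M h a u w" and b: "near M h b v z"
    and M: "1 \<le> M" and h: "0 < h" "h \<le> 1 / (12 * M)"
  shows "sph_dist a b \<le> 12 * M * h"
    and "\<bar>(sph_dist a b)\<^sup>2 - (v - u)\<^sup>2\<bar> \<le> 2000 * M ^ 4 * h ^ 4"
proof -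
  define x d where "x = sph_dist a b" and "d = v - u"
  define e f where "e = a - (circ u + w)" and "f = b - (circ v + z)"
  note A = a[unfolded near_def] and B = b[unfolded near_def]
  have Mh: "12 * M * h \<le> 1" using h M by (simp add: field_simps)
  have h1: "h \<le> 1" using Mh M h mult_right_mono[of 1 "12 * M" h] by linarith
  have ab: "a \<in> S2" "b \<in> S2" using A B by auto
  then have [simp]: "norm a = 1" "norm b = 1" by auto
  have "h ^ 4 \<le> h\<^sup>2" "h\<^sup>2 \<le> 1" using h1 h by (auto intro: power_decreasing power_le_one)
  have M2: "M \<le> M\<^sup>2" using M by (simp add: power2_eq_square)
  have M4: "M\<^sup>2 \<le> M ^ 4" using M by (intro power_increasing) auto
  have "(circ u + w) \<bullet> (circ v + z) = cos d + w \<bullet> z"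
    using A B by (simp add: inner_add circ_inner_circ d_def) (simp add: circ_def inner_add inner_commute)
  moreover have "a \<bullet> b = (circ u + w) \<bullet> (circ v + z) + e \<bullet> b + (circ u + w) \<bullet> f"
    by (simp add: e_def f_def inner_add inner_diff)
  ultimately have "a \<bullet> b - cos d = w \<bullet> z + e \<bullet> b + (circ u + w) \<bullet> f" by simp
  also have "\<bar>\<dots>\<bar> \<le> norm w * norm z + norm e + (1 + norm w) * norm f"
  proof -
    have "\<bar>w \<bullet> z\<bar> \<le> norm w * norm z" "\<bar>e \<bullet> b\<bar> \<le> norm e"
      using Cauchy_Schwarz_ineq2[of w z] Cauchy_Schwarz_ineq2[of e b] by auto
    moreover have "\<bar>(circ u + w) \<bullet> f\<bar> \<le> (1 + norm w) * norm f"
      by (rule order_trans[OF Cauchy_Schwarz_ineq2])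
        (use norm_triangle_ineq[of "circ u" w] in \<open>auto intro: mult_right_mono\<close>)
    ultimately show ?thesis by linarith
  qed
  also have "\<dots> \<le> (M * h\<^sup>2) * (M * h\<^sup>2) + M * h ^ 4 + (1 + M) * (M * h ^ 4)"
  proof (intro add_mono mult_mono)
    have "M * h\<^sup>2 \<le> M" using M \<open>h\<^sup>2 \<le> 1\<close> by simp
    then show "norm w \<le> M" using A by linarith
  qed (use A B M in \<open>auto simp: e_def f_def\<close>)
  also have "\<dots> = (2 * M\<^sup>2 + 2 * M) * h ^ 4" by (simp add: algebra_simps eval_nat_numeral)
  also have "\<dots> \<le> (4 * M\<^sup>2) * h ^ 4" using M2 by (intro mult_right_mono) auto
  finally have cd: "\<bar>a \<bullet> b - cos d\<bar> \<le> 4 * M\<^sup>2 * h ^ 4" .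
  have d: "\<bar>d\<bar> \<le> 2 * M * h" using A B unfolding d_def by linarith
  have d2: "d\<^sup>2 \<le> (2 * M * h)\<^sup>2" using d power_mono[of "\<bar>d\<bar>" "2 * M * h" 2] by simp
  have d4: "d ^ 4 \<le> (2 * M * h) ^ 4" using d power_mono[of "\<bar>d\<bar>" "2 * M * h" 4] by simp
  have "1 - cos d = 2 * (sin (d / 2))\<^sup>2" using cos_double_sin[of "d / 2"] by simp
  moreover have "(sin (d / 2))\<^sup>2 \<le> (d / 2)\<^sup>2"
    using abs_sin_x_le_abs_x[of "d / 2"] by (rule abs_le_square_iff[THEN iffD1])
  ultimately have "1 - cos d \<le> d\<^sup>2 / 2" by (simp add: power_divide)
  \<comment> \<open>A crude bound on the chord comes first; the fourth power of the distance must be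
    known to be O(h^4) before the sharp comparison below.\<close>
  then have "norm (a - b) ^ 2 \<le> d\<^sup>2 + 8 * M\<^sup>2 * h ^ 4"
    using cd sphere_chord(1)[OF ab] by linarith
  also have "\<dots> \<le> (2 * M * h)\<^sup>2 + 8 * M\<^sup>2 * h\<^sup>2"
    using \<open>h ^ 4 \<le> h\<^sup>2\<close> by (intro add_mono d2 mult_left_mono) auto
  also have "\<dots> \<le> (4 * M * h)\<^sup>2" by (simp add: power_mult_distrib)
  finally have "norm (a - b) \<le> 4 * M * h" using h M by (auto intro: power2_le_imp_le)
  then show x: "sph_dist a b \<le> 12 * M * h" using sph_dist_le_chord[OF ab] by linarith
  have x4: "x ^ 4 \<le> (12 * M * h) ^ 4"
    using x sphere_chord(4)[OF ab] by (auto simp: x_def intro: power_mono)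
  \<comment> \<open>Squares are compared through 1 - x^2/2, which avoids the unbounded slope of
    \<open>arccos\<close> at 1.\<close>
  have "\<bar>x\<^sup>2 - d\<^sup>2\<bar> \<le> 2 * \<bar>cos x - cos d\<bar> + x ^ 4 / 12 + d ^ 4 / 12"
  proof -
    define p q where "p = cos x - (1 - x\<^sup>2 / 2)" and "q = cos d - (1 - d\<^sup>2 / 2)"
    have "x\<^sup>2 - d\<^sup>2 = 2 * p - 2 * q - 2 * (cos x - cos d)"
      by (simp add: p_def q_def field_simps)
    moreover have "\<bar>p\<bar> \<le> x ^ 4 / 24" "\<bar>q\<bar> \<le> d ^ 4 / 24"
      unfolding p_def q_def by (rule cos_quadratic_approx)+
    ultimately show ?thesis by argo
  qed
  also have "\<dots> \<le> 2 * (4 * M\<^sup>2 * h ^ 4) + (12 * M * h) ^ 4 / 12 + (2 * M * h) ^ 4 / 12"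
    using cd x4 d4 sphere_chord(3)[OF ab] by (intro add_mono) (auto simp: x_def)
  also have "\<dots> = (8 * M\<^sup>2 + (1728 + 4 / 3) * M ^ 4) * h ^ 4"
    by (simp add: power_mult_distrib algebra_simps)
  also have "\<dots> \<le> (2000 * M ^ 4) * h ^ 4" using M4 power_increasing[of 1 4 M] M by (intro mult_right_mono) auto
  finally show "\<bar>(sph_dist a b)\<^sup>2 - (v - u)\<^sup>2\<bar> \<le> 2000 * M ^ 4 * h ^ 4"
    by (simp add: x_def d_def)
qed

text \<open>The affine rule for (u, w) is proved by trading, one at a time, each exact ingredient of
  SLERP for its model; every trade costs O(h^4).\<close>

lemma near_slerp:
  assumes a: "near M h a u w" and b: "near M h b v z" and t: "\<bar>t\<bar> \<le> 2"
    and M: "1 \<le> M" and h: "0 < h" "h \<le> 1 / (12 * M)"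
  shows "near (slerp_const M) h (slerp a b t) (lerp u v t) (lerp w z t)"
proof -
  define x d where "x = sph_dist a b" and "d = v - u"
  define e f where "e = a - (circ u + w)" and "f = b - (circ v + z)"
  define P P' where "P = slerp_coeff (1 - t) (x\<^sup>2)" and "P' = slerp_coeff (1 - t) (d\<^sup>2)"
  define Q Q' where "Q = slerp_coeff t (x\<^sup>2)" and "Q' = slerp_coeff t (d\<^sup>2)"
  note A = a[unfolded near_def] and B = b[unfolded near_def]
  have Mh: "12 * M * h \<le> 1" using h M by (simp add: field_simps)
  have ab: "a \<in> S2" "b \<in> S2" using A B by auto
  then have [simp]: "norm a = 1" "norm b = 1" by auto
  have t3: "\<bar>t\<bar> \<le> 3" "\<bar>1 - t\<bar> \<le> 3" using t by auto
  have M4: "M \<le> M ^ 4" "M ^ 3 \<le> M ^ 4"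
    using power_increasing[of 1 4 M] power_increasing[of 3 4 M] M by auto
  have x: "x \<le> 12 * M * h" and xd: "\<bar>x\<^sup>2 - d\<^sup>2\<bar> \<le> 2000 * M ^ 4 * h ^ 4"
    using near_sph_dist[OF a b M h] by (auto simp: x_def d_def)
  have x1: "x \<le> 1" "0 \<le> x" using x Mh sphere_chord(4)[OF ab] by (auto simp: x_def)
  have d: "\<bar>d\<bar> \<le> 2 * M * h" using A B unfolding d_def by linarith
  have d1: "\<bar>d\<bar> \<le> 1" using d Mh mult_nonneg_nonneg[of M h] M h by linarith
  have d2: "d\<^sup>2 \<le> 4 * M\<^sup>2 * h\<^sup>2" using d power_mono[of "\<bar>d\<bar>" "2 * M * h" 2] by (simp add: power_mult_distrib)
  have d4: "d ^ 4 \<le> 16 * M ^ 4 * h ^ 4" using d power_mono[of "\<bar>d\<bar>" "2 * M * h" 4] by (simp add: power_mult_distrib)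
  have x4: "x ^ 4 \<le> 20736 * M ^ 4 * h ^ 4"
    using power_mono[OF x x1(2), of 4] by (simp add: power_mult_distrib)
  have d21: "\<bar>d\<^sup>2\<bar> \<le> 1" using d1 by (simp add: abs_square_le_1)
  have v: "v = u + d" and ut: "(1 - t) * u + t * v = u + t * d" by (auto simp: d_def algebra_simps)

  let ?E1 = "slerp a b t - (P *\<^sub>R a + Q *\<^sub>R b)"
  let ?E2 = "P' *\<^sub>R circ u + Q' *\<^sub>R circ v - circ (u + t * d)"
  \<comment> \<open>In turn: exact weights become polynomial ones, the squared distance becomes d^2,
    the endpoints become their coordinate forms, the circle part becomes exact, and the weights of
    \<open>w\<close> and \<open>z\<close> become flat. In the last two terms d^2 and the
    displacement each supply h^2.\<close>
  have "slerp a b t - (circ (u + t * d) + ((1 - t) *\<^sub>R w + t *\<^sub>R z))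
    = ?E1 + (P - P') *\<^sub>R a + (Q - Q') *\<^sub>R b + P' *\<^sub>R e + Q' *\<^sub>R f
      + ?E2 + (P' - (1 - t)) *\<^sub>R w + (Q' - t) *\<^sub>R z"
    by (simp add: e_def f_def algebra_simps)
  also have "norm \<dots> \<le> norm ?E1 + norm ((P - P') *\<^sub>R a) + norm ((Q - Q') *\<^sub>R b) + norm (P' *\<^sub>R e)
      + norm (Q' *\<^sub>R f) + norm ?E2 + norm ((P' - (1 - t)) *\<^sub>R w) + norm ((Q' - t) *\<^sub>R z)"
    by (intro norm_triangle_le add_mono order_refl)
  also have "\<dots> \<le> 12 * (20736 * M ^ 4 * h ^ 4) + 4 * (2000 * M ^ 4 * h ^ 4) + 4 * (2000 * M ^ 4 * h ^ 4)
      + 7 * (M * h ^ 4) + 7 * (M * h ^ 4) + 12 * (16 * M ^ 4 * h ^ 4)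
      + (16 * M\<^sup>2 * h\<^sup>2) * (M * h\<^sup>2) + (16 * M\<^sup>2 * h\<^sup>2) * (M * h\<^sup>2)"
  proof (intro add_mono)
    show "norm ?E1 \<le> 12 * (20736 * M ^ 4 * h ^ 4)"
      using slerp_approx[OF ab _ t] x1 x4 unfolding x_def P_def Q_def by fastforce
    show "norm ((P - P') *\<^sub>R a) \<le> 4 * (2000 * M ^ 4 * h ^ 4)"
      using slerp_coeff_bound(1)[OF t3(2), of "x\<^sup>2" "d\<^sup>2"] xd by (simp add: P_def P'_def)
    show "norm ((Q - Q') *\<^sub>R b) \<le> 4 * (2000 * M ^ 4 * h ^ 4)"
      using slerp_coeff_bound(1)[OF t3(1), of "x\<^sup>2" "d\<^sup>2"] xd by (simp add: Q_def Q'_def)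
    show "norm (P' *\<^sub>R e) \<le> 7 * (M * h ^ 4)"
      unfolding norm_scaleR P'_def e_def
      by (intro mult_mono slerp_coeff_bound(3) t3 d21) (use A in auto)
    show "norm (Q' *\<^sub>R f) \<le> 7 * (M * h ^ 4)"
      unfolding norm_scaleR Q'_def f_def
      by (intro mult_mono slerp_coeff_bound(3) t3 d21) (use B in auto)
    show "norm ?E2 \<le> 12 * (16 * M ^ 4 * h ^ 4)"
      using circ_approx[OF d1 t, of u] d4 unfolding P'_def Q'_def v by linarith
    show "norm ((P' - (1 - t)) *\<^sub>R w) \<le> (16 * M\<^sup>2 * h\<^sup>2) * (M * h\<^sup>2)"
      unfolding norm_scaleR
      using slerp_coeff_bound(2)[OF t3(2), of "d\<^sup>2"] d2 A
      by (intro mult_mono) (auto simp: P'_def)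
    show "norm ((Q' - t) *\<^sub>R z) \<le> (16 * M\<^sup>2 * h\<^sup>2) * (M * h\<^sup>2)"
      unfolding norm_scaleR
      using slerp_coeff_bound(2)[OF t3(1), of "d\<^sup>2"] d2 B
      by (intro mult_mono) (auto simp: Q'_def)
  qed
  also have "\<dots> = (265024 * M ^ 4 + 14 * M + 32 * M ^ 3) * h ^ 4"
    by (simp add: algebra_simps eval_nat_numeral)
  also have "\<dots> \<le> (300000 * M ^ 4) * h ^ 4" using M4 M by (intro mult_right_mono) auto
  finally have err: "norm (slerp a b t - (circ (u + t * d) + ((1 - t) *\<^sub>R w + t *\<^sub>R z))) \<le> 300000 * M ^ 4 * h ^ 4" .
  have M5: "3 * M + 2 * M \<le> 300000 * M ^ 4" using M4 M by linarith
  have "\<bar>(1 - t) * u + t * v\<bar> \<le> \<bar>1 - t\<bar> * \<bar>u\<bar> + \<bar>t\<bar> * \<bar>v\<bar>"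
    by (metis abs_mult abs_triangle_ineq)
  also have "\<dots> \<le> 3 * (M * h) + 2 * (M * h)"
    using A B t t3 by (intro add_mono mult_mono) auto
  also have "\<dots> \<le> 300000 * M ^ 4 * h" using mult_right_mono[OF M5, of h] h by (simp add: algebra_simps)
  finally have u: "\<bar>(1 - t) * u + t * v\<bar> \<le> 300000 * M ^ 4 * h" .
  have "norm ((1 - t) *\<^sub>R w + t *\<^sub>R z) \<le> \<bar>1 - t\<bar> * norm w + \<bar>t\<bar> * norm z"
    by (metis norm_scaleR norm_triangle_ineq)
  also have "\<dots> \<le> 3 * (M * h\<^sup>2) + 2 * (M * h\<^sup>2)"
    using A B t t3 by (intro add_mono mult_mono) auto
  also have "\<dots> \<le> 300000 * M ^ 4 * h\<^sup>2" using mult_right_mono[OF M5, of "h\<^sup>2"] by (simp add: algebra_simps)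
  finally have w: "norm ((1 - t) *\<^sub>R w + t *\<^sub>R z) \<le> 300000 * M ^ 4 * h\<^sup>2" .
  have "near (300000 * M ^ 4) h (slerp a b t) ((1 - t) * u + t * v) ((1 - t) *\<^sub>R w + t *\<^sub>R z)"
    unfolding near_def using err u w A B slerp_in_sphere[OF ab]
    by (simp add: ut inner_add)
  then show ?thesis by (simp add: slerp_const_def lerp_def)
qed

section \<open>Changing constants, coordinates of the curve, and passage through SIDER3\<close>

lemma near_mono:
  assumes "near M h a u w" "M \<le> M'" "0 \<le> h"
  shows "near M' h a u w"
  using assms mult_right_mono[OF assms(2), of h] mult_right_mono[OF assms(2), of "h\<^sup>2"]
    mult_right_mono[OF assms(2), of "h ^ 4"] unfolding near_def by fastforce

text \<open>Taylor bounds come in powers of s, the scheme needs powers of h; 81 = 3^4 also covers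
  the factors 3 and 9 of the lower scales.\<close>

lemma near_rescale:
  assumes "near M s a u w" "0 \<le> s" "s \<le> 3 * h" "0 \<le> M"
  shows "near (81 * M) h a u w"
proof -
  have h: "0 \<le> h" using assms by linarith
  have "M * s \<le> M * (3 * h)" "M * s\<^sup>2 \<le> M * (3 * h)\<^sup>2" "M * s ^ 4 \<le> M * (3 * h) ^ 4"
    by (intro mult_left_mono power_mono assms)+
  moreover have "0 \<le> M * h" "0 \<le> M * h\<^sup>2" using h assms by auto
  ultimately show ?thesis using assms(1) unfolding near_def
    by (simp add: power_mult_distrib)
qed

text \<open>The displacement is the part of the Taylor polynomial orthogonal to \<open>N\<close> and
  \<open>V\<close>. The extra k^3/6 in the angle compensates the cubic term of the sine, so that sin
  U matches the \<open>V\<close>-component of \<open>g\<close> up to s^4.\<close>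

lemma near_curve:
  fixes c2 c3 :: "real^3" and k L s :: real
  assumes g: "g \<in> S2" and s: "0 \<le> s" "s \<le> 1 / (8 * L)" and L: "1 \<le> L"
    and R: "norm (g - (N + s *\<^sub>R (k *\<^sub>R V) + s\<^sup>2 *\<^sub>R c2 + s ^ 3 *\<^sub>R c3)) \<le> L * s ^ 4"
    and k: "\<bar>k\<bar> \<le> L" and c2: "norm c2 \<le> L" and c3: "norm c3 \<le> L" "\<bar>V \<bullet> c3 + k ^ 3 / 6\<bar> \<le> L"
  defines "proj \<equiv> \<lambda>x. x - (N \<bullet> x) *\<^sub>R N - (V \<bullet> x) *\<^sub>R V"
  shows "near (100 * L ^ 5) s g (s * k + s\<^sup>2 * (V \<bullet> c2) + s ^ 3 * (V \<bullet> c3 + k ^ 3 / 6))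
    (s\<^sup>2 *\<^sub>R proj c2 + s ^ 3 *\<^sub>R proj c3)"
proof -
  define U where "U = s * k + s\<^sup>2 * (V \<bullet> c2) + s ^ 3 * (V \<bullet> c3 + k ^ 3 / 6)"
  define W where "W = s\<^sup>2 *\<^sub>R proj c2 + s ^ 3 *\<^sub>R proj c3"
  define r where "r = g - (N + s *\<^sub>R (k *\<^sub>R V) + s\<^sup>2 *\<^sub>R c2 + s ^ 3 *\<^sub>R c3)"
  have gr: "g = N + s *\<^sub>R (k *\<^sub>R V) + s\<^sup>2 *\<^sub>R c2 + s ^ 3 *\<^sub>R c3 + r" by (simp add: r_def)
  have [simp]: "norm g = 1" using g by simp
  have gg: "g \<bullet> g = 1" by (simp flip: power2_norm_eq_inner)
  have Ls: "L * s \<le> 1 / 8" using s L by (simp add: field_simps)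
  have "s \<le> L * s" using L s by (simp add: mult_right_mono[of 1 L s, simplified])
  then have s1: "s \<le> 1" using Ls by linarith
  have pw: "s\<^sup>2 \<le> s" "s ^ 3 \<le> s" "s ^ 3 \<le> s\<^sup>2" "s ^ 4 \<le> s\<^sup>2" "s ^ 4 \<le> s" "s ^ 5 \<le> s ^ 4"
    using s s1 power_decreasing[of 1 2 s] power_decreasing[of 1 3 s] power_decreasing[of 1 4 s]
    by (auto intro: power_decreasing)
  have Lp: "L \<le> L ^ 5" "L\<^sup>2 \<le> L ^ 5" "L ^ 3 \<le> L ^ 5"
    using power_increasing[of 1 5 L] L by (auto intro: power_increasing)
  have nproj: "norm (proj x) \<le> norm x" for x
  proof -
    have "(norm (proj x))\<^sup>2 = (norm x)\<^sup>2 - (N \<bullet> x)\<^sup>2 - (V \<bullet> x)\<^sup>2"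
      unfolding proj_def power2_norm_eq_inner
      by (simp add: inner_diff inner_commute[of x N] inner_commute[of x V] power2_eq_square)
    then have "(norm (proj x))\<^sup>2 \<le> (norm x)\<^sup>2" by simp
    then show ?thesis by (rule power2_le_imp_le) simp
  qed
  have pr: "norm r \<le> L * s ^ 4" using R by (simp add: r_def)
  have Vr: "\<bar>V \<bullet> r\<bar> \<le> L * s ^ 4" using Cauchy_Schwarz_ineq2[of V r] pr by simp
  have Vc2: "\<bar>V \<bullet> c2\<bar> \<le> L" using Cauchy_Schwarz_ineq2[of V c2] c2 by simp

  have "\<bar>U - s * k\<bar> \<le> s\<^sup>2 * \<bar>V \<bullet> c2\<bar> + s ^ 3 * \<bar>V \<bullet> c3 + k ^ 3 / 6\<bar>"
    using abs_triangle_ineq[of "s\<^sup>2 * (V \<bullet> c2)" "s ^ 3 * (V \<bullet> c3 + k ^ 3 / 6)"] s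
    by (simp add: U_def abs_mult)
  also have "\<dots> \<le> s\<^sup>2 * L + s\<^sup>2 * L"
    using s c3 Vc2 L pw by (intro add_mono mult_mono) auto
  finally have Uk: "\<bar>U - s * k\<bar> \<le> 2 * L * s\<^sup>2" by simp
  have "\<bar>s * k\<bar> \<le> L * s" using mult_right_mono[OF k s(1)] s by (simp add: abs_mult mult.commute)
  moreover have "L * s\<^sup>2 \<le> L * s" using pw L by simp
  ultimately have U: "\<bar>U\<bar> \<le> 3 * L * s" using Uk by linarith
  \<comment> \<open>U differs from s k by O(s^2), so in the cubic term of sin U only the linear part
    of U counts.\<close>
  have "\<bar>U ^ 3 - (s * k) ^ 3\<bar> = \<bar>U - s * k\<bar> * \<bar>U\<^sup>2 + U * (s * k) + (s * k)\<^sup>2\<bar>"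
    unfolding abs_mult[symmetric] by (simp add: algebra_simps eval_nat_numeral)
  also have "\<dots> \<le> (2 * L * s\<^sup>2) * (13 * (L * s)\<^sup>2)"
  proof (intro mult_mono Uk)
    have "\<bar>U\<^sup>2\<bar> \<le> 9 * (L * s)\<^sup>2" using power_mono[OF U, of 2] by (simp add: power_mult_distrib)
    moreover have "\<bar>(s * k)\<^sup>2\<bar> \<le> (L * s)\<^sup>2" using power_mono[OF \<open>\<bar>s * k\<bar> \<le> L * s\<close>, of 2] by simp
    moreover have "\<bar>U * (s * k)\<bar> \<le> (3 * L * s) * (L * s)"
      unfolding abs_mult[of U] by (intro mult_mono U \<open>\<bar>s * k\<bar> \<le> L * s\<close>) (use L s in auto)
    moreover have "(3 * L * s) * (L * s) = 3 * (L * s)\<^sup>2" by (simp add: power2_eq_square)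
    ultimately show "\<bar>U\<^sup>2 + U * (s * k) + (s * k)\<^sup>2\<bar> \<le> 13 * (L * s)\<^sup>2" by linarith
  qed (use L in auto)
  finally have U3: "\<bar>U ^ 3 - (s * k) ^ 3\<bar> \<le> 26 * L ^ 3 * s ^ 4"
    by (simp add: eval_nat_numeral algebra_simps)
  have "\<bar>U\<bar> ^ 5 \<le> 243 * L ^ 5 * s ^ 5"
    using power_mono[OF U, of 5] by (simp add: power_mult_distrib)
  also have "\<dots> \<le> 243 * L ^ 5 * s ^ 4" using pw L by (intro mult_left_mono) auto
  finally have U5: "\<bar>U\<bar> ^ 5 \<le> 243 * L ^ 5 * s ^ 4" .
  have Vg: "V \<bullet> g = U - (s * k) ^ 3 / 6 + V \<bullet> r"
    by (subst gr) (simp add: U_def inner_add power_mult_distrib algebra_simps)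
  have le: "L * s ^ 4 \<le> L ^ 5 * s ^ 4" "L\<^sup>2 * s ^ 4 \<le> L ^ 5 * s ^ 4" "L ^ 3 * s ^ 4 \<le> L ^ 5 * s ^ 4"
    using Lp s by (auto intro: mult_right_mono)
  have "sin U - V \<bullet> g = (sin U - (U - U ^ 3 / 6)) - (U ^ 3 - (s * k) ^ 3) / 6 - V \<bullet> r"
    by (simp add: Vg field_simps)
  then have "\<bar>sin U - V \<bullet> g\<bar>
    \<le> \<bar>sin U - (U - U ^ 3 / 6)\<bar> + \<bar>U ^ 3 - (s * k) ^ 3\<bar> / 6 + \<bar>V \<bullet> r\<bar>" by argo
  also have "\<dots> \<le> 243 * (L ^ 5 * s ^ 4) / 120 + 26 * (L ^ 5 * s ^ 4) / 6 + L ^ 5 * s ^ 4"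
    using sin_cubic_approx[of U] U5 U3 Vr le by (intro add_mono) auto
  finally have sinU: "\<bar>sin U - V \<bullet> g\<bar> \<le> 9 * (L ^ 5 * s ^ 4)"
    using Lp L zero_le_power[of L 5] zero_le_power[OF s(1), of 4] mult_nonneg_nonneg[of "L ^ 5" "s ^ 4"] by linarith

  have pg: "proj g = W + proj r"
    by (subst gr) (simp add: proj_def W_def inner_add algebra_simps)
  have "norm W \<le> s\<^sup>2 * norm (proj c2) + s ^ 3 * norm (proj c3)"
    unfolding W_def using s by (intro order_trans[OF norm_triangle_ineq]) simp
  also have "\<dots> \<le> s\<^sup>2 * L + s\<^sup>2 * L"
    using s c2 c3 L pw order_trans[OF nproj] by (intro add_mono mult_mono) auto
  finally have W: "norm W \<le> 2 * L * s\<^sup>2" by simp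
  have "norm (proj r) \<le> L * s ^ 4" using nproj[of r] pr by linarith
  moreover have "L * s ^ 4 \<le> L * s\<^sup>2" using pw L by simp
  ultimately have "norm (proj g) \<le> 3 * L * s\<^sup>2"
    using W norm_triangle_ineq[of W "proj r"] by (simp add: pg)
  then have "(norm (proj g))\<^sup>2 \<le> (3 * L * s\<^sup>2)\<^sup>2" by (intro power_mono) auto
  also have "\<dots> = 9 * (L\<^sup>2 * s ^ 4)" by (simp add: power_mult_distrib eval_nat_numeral)
  finally have pg2: "(norm (proj g))\<^sup>2 \<le> 9 * (L ^ 5 * s ^ 4)" using le by linarith

  \<comment> \<open>The \<open>N\<close>-component is not read off the Taylor polynomial but
    recovered from the unit length of \<open>g\<close>; the squared displacement is already
    O(s^4).\<close>
  have "(norm (proj g))\<^sup>2 = 1 - (N \<bullet> g)\<^sup>2 - (V \<bullet> g)\<^sup>2"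
    unfolding proj_def power2_norm_eq_inner
    by (simp add: inner_diff inner_commute[of g N] inner_commute[of g V] power2_eq_square gg)
  then have "(N \<bullet> g)\<^sup>2 - (cos U)\<^sup>2 = (sin U - V \<bullet> g) * (sin U + V \<bullet> g) - (norm (proj g))\<^sup>2"
    by (simp add: cos_squared_eq algebra_simps power2_eq_square)
  also have "\<bar>\<dots>\<bar> \<le> \<bar>sin U - V \<bullet> g\<bar> * 2 + (norm (proj g))\<^sup>2"
  proof -
    have "\<bar>V \<bullet> g\<bar> \<le> 1" using Cauchy_Schwarz_ineq2[of V g] by simp
    then have "\<bar>sin U + V \<bullet> g\<bar> \<le> 2" using abs_sin_le_one[of U] by linarith
    then have "\<bar>(sin U - V \<bullet> g) * (sin U + V \<bullet> g)\<bar> \<le> \<bar>sin U - V \<bullet> g\<bar> * 2"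
      unfolding abs_mult by (intro mult_left_mono) auto
    then show ?thesis using zero_le_power2[of "norm (proj g)"] by linarith
  qed
  finally have sq: "\<bar>(N \<bullet> g)\<^sup>2 - (cos U)\<^sup>2\<bar> \<le> 27 * (L ^ 5 * s ^ 4)" using sinU pg2 by argo
  have "norm (g - N) \<le> norm (s *\<^sub>R (k *\<^sub>R V)) + norm (s\<^sup>2 *\<^sub>R c2) + norm (s ^ 3 *\<^sub>R c3) + norm r"
  proof -
    have "g - N = s *\<^sub>R (k *\<^sub>R V) + s\<^sup>2 *\<^sub>R c2 + s ^ 3 *\<^sub>R c3 + r" by (simp add: r_def)
    then show ?thesis by (simp only:) (intro norm_triangle_le add_mono order_refl)
  qed
  also have "\<dots> \<le> s * L + s * L + s * L + s * L"
  proof (intro add_mono)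
    show "norm r \<le> s * L" using pr pw L by (smt (verit) mult.commute mult_left_mono)
  qed (use s k c2 c3 L pw in \<open>auto simp: abs_mult mult_mono mult_left_mono\<close>)
  also have "\<dots> \<le> 1 / 2" using Ls by (simp add: mult.commute)
  finally have gN: "norm (g - N) \<le> 1 / 2" .
  have "N \<bullet> g = 1 + N \<bullet> (g - N)" by (simp add: inner_diff)
  \<comment> \<open>With \<open>cos U\<close> also at least 1/2, the sum of the two is at least 1,
    and the difference of squares bounds the difference.\<close>
  then have Ng: "1 / 2 \<le> N \<bullet> g" using Cauchy_Schwarz_ineq2[of N "g - N"] gN by simp
  have "\<bar>U\<bar> \<le> 1 / 2" using U Ls by linarith
  then have "U\<^sup>2 \<le> 1 / 4" "U ^ 4 \<le> 1 / 16"
    using power_mono[of "\<bar>U\<bar>" "1 / 2" 2] power_mono[of "\<bar>U\<bar>" "1 / 2" 4] by (auto simp: power_divide)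
  then have cU: "1 / 2 \<le> cos U" using cos_quadratic_approx[of U] by linarith
  have "\<bar>N \<bullet> g - cos U\<bar> * 1 \<le> \<bar>N \<bullet> g - cos U\<bar> * \<bar>N \<bullet> g + cos U\<bar>"
    using Ng cU by (intro mult_left_mono) auto
  also have "\<dots> = \<bar>(N \<bullet> g)\<^sup>2 - (cos U)\<^sup>2\<bar>"
    unfolding abs_mult[symmetric] by (simp add: algebra_simps power2_eq_square)
  finally have cosU: "\<bar>N \<bullet> g - cos U\<bar> \<le> 27 * (L ^ 5 * s ^ 4)" using sq by argo

  have "g - (circ U + W) = (N \<bullet> g - cos U) *\<^sub>R N + (V \<bullet> g - sin U) *\<^sub>R V + proj r"
  proof -
    have "g = (N \<bullet> g) *\<^sub>R N + (V \<bullet> g) *\<^sub>R V + proj g" by (simp add: proj_def)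
    then have "g - (circ U + W) = (N \<bullet> g) *\<^sub>R N + (V \<bullet> g) *\<^sub>R V + (W + proj r) - (circ U + W)"
      unfolding pg by simp
    then show ?thesis by (simp add: circ_def algebra_simps)
  qed
  also have "norm \<dots> \<le> \<bar>N \<bullet> g - cos U\<bar> + \<bar>sin U - V \<bullet> g\<bar> + norm (proj r)"
    by (intro norm_triangle_le add_mono) (auto simp: abs_minus_commute)
  also have "\<dots> \<le> 100 * (L ^ 5 * s ^ 4)"
    using cosU sinU \<open>norm (proj r) \<le> L * s ^ 4\<close> le(1)
      mult_nonneg_nonneg[of "L ^ 5" "s ^ 4"] L s by simp
  finally have err: "norm (g - (circ U + W)) \<le> 100 * L ^ 5 * s ^ 4" by simp
  have "3 * L \<le> 100 * L ^ 5" "2 * L \<le> 100 * L ^ 5" using Lp(1) L by linarith+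
  then have "3 * L * s \<le> 100 * L ^ 5 * s" "2 * L * s\<^sup>2 \<le> 100 * L ^ 5 * s\<^sup>2"
    using s by (intro mult_right_mono; simp)+
  then have "\<bar>U\<bar> \<le> 100 * L ^ 5 * s" "norm W \<le> 100 * L ^ 5 * s\<^sup>2" using U W by linarith+
  moreover have "N \<bullet> W = 0" "V \<bullet> W = 0" by (simp_all add: W_def proj_def inner_add inner_diff)
  ultimately show ?thesis using g err by (simp add: near_def U_def W_def)
qed

text \<open>Constants are indexed by nesting depth: data 0, extrapolated points 1, inner curves 2,
  SIDER2 3, result 4. The last SLERP has inputs at level 3, the largest level at which
  \<open>h\<close> must be small.\<close>

lemma near_sider3:
  assumes p: "\<And>i. i \<le> 3 \<Longrightarrow> near M h (p i) (u i) (w i)" and M: "1 \<le> M"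
    and h: "0 < h" "h \<le> 1 / (12 * (slerp_const ^^ 3) M)" and s: "s \<in> {0..3*h}"
  shows "near ((slerp_const ^^ 4) M) h (sider3 h p s) (flat_sider3 u (s / h)) (flat_sider3 w (s / h))"
proof -
  let ?K = "\<lambda>n. (slerp_const ^^ n) M"
  have K1: "1 \<le> ?K n" for n
    by (induction n) (use M slerp_const_ge order_trans in \<open>auto simp del: One_nat_def\<close>)
  have mono: "?K m \<le> ?K n" if "m \<le> n" for m n
    using that by (rule lift_Suc_mono_le[rotated]) (simp add: slerp_const_ge K1)
  have hK: "h \<le> 1 / (12 * ?K n)" if "n \<le> 3" for n
    using mono[OF that] K1[of n] h
    by (intro order_trans[OF h(2)] divide_left_mono mult_left_mono mult_pos_pos) (auto intro: less_le_trans[OF zero_less_one K1])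
  have step: "near (?K (Suc n)) h (slerp a b t) (lerp x y t) (lerp x' y' t)"
    if "near (?K n) h a x x'" "near (?K n) h b y y'" "\<bar>t\<bar> \<le> 2" "n \<le> 3" for n a b x y x' y' t
    using near_slerp[OF that(1-3) K1 h(1) hK[OF that(4)]] by simp
  have weaken: "near (?K n) h a x x'" if "near (?K m) h a x x'" "m \<le> n" for m n a x x'
    using near_mono[OF that(1) mono[OF that(2)]] h by simp
  have p0: "near (?K 0) h (p i) (u i) (w i)" if "i \<le> 3" for i using p[OF that] by simp
  \<comment> \<open>The inner curves join a data point to an extrapolated one, so the data are
    raised to level 1.\<close>
  have p1: "near (?K 1) h (p i) (u i) (w i)" if "i \<le> 3" for i using weaken[OF p0[OF that], of 1] by simp
  have sh: "0 \<le> s / h" "s / h \<le> 3" using s h by (auto simp: field_simps)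
  have s2: "near (?K 3) h (sider2 h p i s) (flat_sider2 u i (loc_param h i s)) (flat_sider2 w i (loc_param h i s))"
    if "i \<le> 1" for i
  proof -
    \<comment> \<open>The local parameter ranges over [-1/2, 3/2], since both SIDER2 curves are used
      on all of [0, 3h].\<close>
    have t: "\<bar>loc_param h i s\<bar> \<le> 2" using sh that by (auto simp: loc_param_def)
    have ext: "near (?K 1) h (extrap_a p i) (lerp (u (i + 2)) (u (i + 1)) 2) (lerp (w (i + 2)) (w (i + 1)) 2)"
      "near (?K 1) h (extrap_b p i) (lerp (u i) (u (i + 1)) 2) (lerp (w i) (w (i + 1)) 2)"
      using step[OF p0[of "i + 2"] p0[of "i + 1"], of 2] step[OF p0[of i] p0[of "i + 1"], of 2] that
      by (simp_all add: extrap_a_def extrap_b_def)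
    have a: "near (?K 2) h (inner_a h p i s)
        (lerp (u i) (lerp (u (i + 2)) (u (i + 1)) 2) (loc_param h i s))
        (lerp (w i) (lerp (w (i + 2)) (w (i + 1)) 2) (loc_param h i s))"
      using step[OF p1[of i] ext(1) t] that unfolding inner_a_def numeral_2_eq_2[symmetric] Suc_1 by simp
    have b: "near (?K 2) h (inner_b h p i s)
        (lerp (lerp (u i) (u (i + 1)) 2) (u (i + 2)) (loc_param h i s))
        (lerp (lerp (w i) (w (i + 1)) 2) (w (i + 2)) (loc_param h i s))"
      using step[OF ext(2) p1[of "i + 2"] t] that unfolding inner_b_def numeral_2_eq_2[symmetric] Suc_1 by simp
    show ?thesis
      using step[OF a b t] by (simp add: sider2_def flat_sider2_def numeral_2_eq_2 numeral_3_eq_3)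
  qed
  have "near (?K (Suc 3)) h (sider3 h p s) (flat_sider3 u (s / h)) (flat_sider3 w (s / h))"
    unfolding sider3_def flat_sider3_def
    using step[OF s2[of 0] s2[of 1], of "s / h / 3"] sh by (simp add: loc_param_def)
  then show ?thesis by (simp add: eval_nat_numeral)
qed

end

subsection \<open>Taylor expansion of the curve\<close>

lemma derivative_bound_power:
  fixes f :: "real \<Rightarrow> 'a::real_normed_vector"
  assumes deriv: "\<And>t. t \<in> {0..T} \<Longrightarrow> (f has_vector_derivative f' t) (at t within {0..T})"
    and "f 0 = 0" and bound: "\<And>t. t \<in> {0..T} \<Longrightarrow> norm (f' t) \<le> K * t ^ n" and K: "0 \<le> K"
    and t: "t \<in> {0..T}"
  shows "norm (f t) \<le> K * t ^ Suc n"
proof -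
  have "norm (f t - f 0) \<le> K * t ^ n * norm (t - 0)"
  proof (rule differentiable_bound[of "{0..t}" f "\<lambda>x y. y *\<^sub>R f' x"])
    fix x assume x: "x \<in> {0..t}"
    then show "(f has_derivative (\<lambda>y. y *\<^sub>R f' x)) (at x within {0..t})"
      using deriv[of x] t unfolding has_vector_derivative_def
      by (auto intro: has_derivative_subset)
    have "K * x ^ n \<le> K * t ^ n" using x K by (auto intro!: mult_left_mono power_mono)
    then show "onorm (\<lambda>y. y *\<^sub>R f' x) \<le> K * t ^ n"
      using bound[of x] x t
      by (intro onorm_le) (auto simp: mult.commute intro!: mult_left_mono)
  qed (use t in auto)
  then show ?thesis using assms(2) t by (simp add: mult_ac)
qed

lemma has_vector_derivative_monomial:
  "((\<lambda>t. (t ^ Suc n / fact (Suc n)) *\<^sub>R v) has_vector_derivative (t ^ n / fact n) *\<^sub>R v) (at t within S)"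
proof -
  have "((\<lambda>t. t ^ Suc n / fact (Suc n)) has_real_derivative (real (Suc n) * t ^ n / fact (Suc n))) (at t within S)"
    using DERIV_pow[of "Suc n" t S] by (intro DERIV_cdivide) (simp only: diff_Suc_Suc diff_zero)
  moreover have "real (Suc n) * t ^ n / fact (Suc n) = t ^ n / fact n"
    unfolding fact_Suc by (simp del: of_nat_Suc)
  ultimately have *: "((\<lambda>t. t ^ Suc n / fact (Suc n)) has_real_derivative t ^ n / fact n) (at t within S)"
    by metis
  show ?thesis
    using has_vector_derivative_scaleR[OF * has_vector_derivative_const[of v]] by simp
qed

text \<open>Vector values admit no Lagrange remainder, so the mean value inequality lifts the bound
  one order at a time. The induction runs over all families \<open>D\<close>, to be applied to the
  shifted family of derivatives; the factor 1/n! is given away.\<close>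

lemma taylor_bound:
  fixes D :: "nat \<Rightarrow> real \<Rightarrow> 'a::real_normed_vector"
  assumes "\<And>j t. j < n \<Longrightarrow> t \<in> {0..T} \<Longrightarrow> (D j has_vector_derivative D (Suc j) t) (at t within {0..T})"
    and "\<And>t. t \<in> {0..T} \<Longrightarrow> norm (D n t) \<le> K" and "0 \<le> K" and "t \<in> {0..T}"
  shows "norm (D 0 t - (\<Sum>i<n. (t ^ i / fact i) *\<^sub>R D i 0)) \<le> K * t ^ n"
  using assms
proof (induction n arbitrary: D t)
  case 0
  then show ?case by simp
next
  case (Suc n)
  have IH: "norm (D (Suc 0) t - (\<Sum>i<n. (t ^ i / fact i) *\<^sub>R D (Suc i) 0)) \<le> K * t ^ n"
    if "t \<in> {0..T}" for t
    using Suc.IH[of "\<lambda>j. D (Suc j)" t] Suc.prems that by simp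
  have shift: "D 0 t - (\<Sum>i<Suc n. (t ^ i / fact i) *\<^sub>R D i 0)
      = D 0 t - D 0 0 - (\<Sum>i<n. (t ^ Suc i / fact (Suc i)) *\<^sub>R D (Suc i) 0)" for t
    by (subst sum.lessThan_Suc_shift) (simp del: fact_Suc power_Suc)
  show ?case
    unfolding shift
  proof (rule derivative_bound_power[OF _ _ IH \<open>0 \<le> K\<close> \<open>t \<in> {0..T}\<close>])
    fix t assume t: "t \<in> {0..T}"
    show "((\<lambda>t. D 0 t - D 0 0 - (\<Sum>i<n. (t ^ Suc i / fact (Suc i)) *\<^sub>R D (Suc i) 0)) has_vector_derivative
      D (Suc 0) t - (\<Sum>i<n. (t ^ i / fact i) *\<^sub>R D (Suc i) 0)) (at t within {0..T})"
      using Suc.prems(1)[of 0 t] t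
      by (intro has_vector_derivative_diff has_vector_derivative_sum has_vector_derivative_monomial)
        (simp add: has_vector_derivative_diff_const)
  qed simp
qed

lemma C4_taylor:
  fixes f :: "real \<Rightarrow> 'a::real_normed_vector"
  assumes C4: "Ck_on 4 f {0..T}" and T: "0 < T"
  obtains c1 c2 c3 K where "(f has_vector_derivative c1) (at 0 within {0..T})" "0 \<le> K"
    "\<And>t. t \<in> {0..T} \<Longrightarrow> norm (f t - (f 0 + t *\<^sub>R c1 + t\<^sup>2 *\<^sub>R c2 + t ^ 3 *\<^sub>R c3)) \<le> K * t ^ 4"
proof -
  obtain D where D0: "\<And>t. t \<in> {0..T} \<Longrightarrow> D 0 t = f t"
    and D: "\<And>j t. j < 4 \<Longrightarrow> t \<in> {0..T} \<Longrightarrow> (D j has_vector_derivative D (Suc j) t) (at t within {0..T})"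
    and cont: "continuous_on {0..T} (D 4)"
    using C4 unfolding Ck_on_def by blast
  \<comment> \<open>The remainder constant is taken over the fixed interval, hence independent of h
    and s.\<close>
  have "bounded (D 4 ` {0..T})" using compact_imp_bounded[OF compact_continuous_image[OF cont]] by simp
  then obtain K where K: "\<And>t. t \<in> {0..T} \<Longrightarrow> norm (D 4 t) \<le> K"
    unfolding bounded_iff by blast
  have K0: "0 \<le> K" using order_trans[OF norm_ge_zero K[of 0]] T by simp
  have zero: "0 \<in> {0..T}" using T by simp
  have sum4: "(\<Sum>i<4. (t ^ i / fact i) *\<^sub>R D i 0)
    = D 0 0 + t *\<^sub>R D 1 0 + t\<^sup>2 *\<^sub>R ((1 / 2) *\<^sub>R D 2 0) + t ^ 3 *\<^sub>R ((1 / 6) *\<^sub>R D 3 0)" for t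
  proof -
    have "{..<4} = {0, 1, 2, 3::nat}" by auto
    then show ?thesis by (simp add: fact_numeral add.assoc)
  qed
  show ?thesis
  proof
    show "(f has_vector_derivative D 1 0) (at 0 within {0..T})"
      using has_vector_derivative_transform[OF zero D0[symmetric] D[of 0 0]] zero by simp
    show "norm (f t - (f 0 + t *\<^sub>R D 1 0 + t\<^sup>2 *\<^sub>R ((1 / 2) *\<^sub>R D 2 0) + t ^ 3 *\<^sub>R ((1 / 6) *\<^sub>R D 3 0)))
      \<le> K * t ^ 4" if "t \<in> {0..T}" for t
      using taylor_bound[OF D K K0 that] unfolding sum4 D0[OF that] D0[OF zero] .
  qed (rule K0)
qed

lemma sphere_curve_derivative_orthogonal:
  fixes f :: "real \<Rightarrow> 'a::real_inner"
  assumes f: "f ` {0..T} \<subseteq> sphere 0 1" and T: "0 < T"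
    and c: "(f has_vector_derivative c) (at 0 within {0..T})"
  shows "f 0 \<bullet> c = 0"
proof -
  have "((\<lambda>t. f t \<bullet> f t) has_vector_derivative (f 0 \<bullet> c + c \<bullet> f 0)) (at 0 within {0..T})"
    using bounded_bilinear.has_vector_derivative[OF bounded_bilinear_inner c c] .
  moreover have "((\<lambda>t. f t \<bullet> f t) has_vector_derivative 0) (at 0 within {0..T})"
  proof (rule has_vector_derivative_transform)
    show "((\<lambda>t. 1) has_vector_derivative 0) (at 0 within {0..T})" by simp
    show "f t \<bullet> f t = 1" if "t \<in> {0..T}" for t
      using image_subset_iff[THEN iffD1, OF f, rule_format, OF that] by (simp flip: power2_norm_eq_inner)
  qed (use T in auto)
  ultimately have "f 0 \<bullet> c + c \<bullet> f 0 = 0"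
    using T by (intro vector_derivative_unique_within_closed_interval[of 0 T 0 "\<lambda>t. f t \<bullet> f t"]) auto
  then show ?thesis by (simp add: inner_commute)
qed

text \<open>If the velocity vanishes, any unit vector orthogonal to \<open>N\<close> serves with k =
  0, so curves stationary at the start are covered.\<close>

lemma unit_tangent:
  fixes N c :: "real^3"
  assumes "N \<bullet> c = 0"
  obtains V k where "norm V = 1" "N \<bullet> V = 0" "c = k *\<^sub>R V"
proof (cases "c = 0")
  case True
  obtain y where "y \<noteq> 0" "orthogonal N y" by (rule orthogonal_to_vector_exists[of N]) auto
  then show ?thesis using that[of "sgn y" 0] True
    by (simp add: norm_sgn sgn_div_norm orthogonal_def)
next
  case False
  then show ?thesis using that[of "sgn c" "norm c"] assms
    by (simp add: norm_sgn sgn_div_norm)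
qed

subsection \<open>Order of accuracy\<close>

theorem theorem1:
  fixes \<gamma> :: "real \<Rightarrow> real^3" and T :: real
    and c :: "real \<Rightarrow> real^3" and r :: "real \<Rightarrow> real"
  assumes "T > 0"
    and "\<gamma> ` {0..T} \<subseteq> S2"
    and "Ck_on 4 \<gamma> {0..T}"
    and "r \<in> O[at_right 0](\<lambda>h. h)"
    and "\<forall>\<^sub>F h in at_right 0. c h \<in> S2 \<and>
           geodesically_convex (geodesic_ball (c h) (r h)) \<and>
           sider3_points h (\<lambda>i. \<gamma> (real i * h)) \<subseteq> geodesic_ball (c h) (r h)"
  shows "\<exists>C. \<forall>\<^sub>F h in at_right 0. \<forall>s\<in>{0..3*h}.
           sph_dist (\<gamma> s) (sider3 h (\<lambda>i. \<gamma> (real i * h)) s) \<le> C * h ^ 4"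
proof -
  note T = \<open>T > 0\<close>
  obtain c1 c2 c3 K where c1: "(\<gamma> has_vector_derivative c1) (at 0 within {0..T})" and K: "0 \<le> K"
    and taylor: "\<And>t. t \<in> {0..T} \<Longrightarrow>
      norm (\<gamma> t - (\<gamma> 0 + t *\<^sub>R c1 + t\<^sup>2 *\<^sub>R c2 + t ^ 3 *\<^sub>R c3)) \<le> K * t ^ 4"
    by (rule C4_taylor[OF assms(3) T]) (rule that, assumption+)
  define N where "N = \<gamma> 0"
  have sphere: "\<gamma> t \<in> S2" if "t \<in> {0..T}" for t using assms(2) that by blast
  have N: "norm N = 1" using sphere[of 0] T by (simp add: N_def)
  have "N \<bullet> c1 = 0" unfolding N_def by (rule sphere_curve_derivative_orthogonal[OF assms(2) T c1])
  then obtain V k where V: "norm V = 1" "N \<bullet> V = 0" and c1_eq: "c1 = k *\<^sub>R V" by (rule unit_tangent)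
  interpret frame N V by unfold_locales (use N V in auto)
  define L where "L = 1 + K + \<bar>k\<bar> + norm c2 + norm c3 + \<bar>V \<bullet> c3 + k ^ 3 / 6\<bar>"
  have L: "1 \<le> L" "K \<le> L" "\<bar>k\<bar> \<le> L" "norm c2 \<le> L" "norm c3 \<le> L" "\<bar>V \<bullet> c3 + k ^ 3 / 6\<bar> \<le> L"
    using K by (auto simp: L_def)
  define proj where "proj x = x - (N \<bullet> x) *\<^sub>R N - (V \<bullet> x) *\<^sub>R V" for x
  \<comment> \<open>Both coordinates, including the zero linear term of \<open>W\<close>, are
    written in the exact shape of the cubic in \<open>flat_sider3_cubic\<close>.\<close>
  define U where "U s = s *\<^sub>R k + s\<^sup>2 *\<^sub>R (V \<bullet> c2) + s ^ 3 *\<^sub>R (V \<bullet> c3 + k ^ 3 / 6)" for s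
  define W where "W s = s *\<^sub>R 0 + s\<^sup>2 *\<^sub>R proj c2 + s ^ 3 *\<^sub>R proj c3" for s
  define M where "M = 81 * (100 * L ^ 5)"
  have M: "1 \<le> M" using one_le_power[OF L(1), of 5] by (simp add: M_def)
  define M4 where "M4 = (slerp_const ^^ 4) M"
  \<comment> \<open>The three bounds keep [0, 3h] inside the domain, make 3h at most 1/(8L) for the
    curve expansion, and meet the smallness condition of \<open>near_sider3\<close>.\<close>
  define h0 where "h0 = Min {T / 3, 1 / (24 * L), 1 / (12 * (slerp_const ^^ 3) M)}"
  have M3: "1 \<le> (slerp_const ^^ n) M" for n
    by (induction n) (use M slerp_const_ge order_trans in \<open>auto simp del: One_nat_def\<close>)
  have "0 < h0" using T L M3[of 3] by (simp add: h0_def)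
  have main: "sph_dist (\<gamma> s) (sider3 h (\<lambda>i. \<gamma> (real i * h)) s) \<le> 3 * (M + M4) * h ^ 4"
    if h: "0 < h" "h < h0" and s: "s \<in> {0..3*h}" for h s
  proof -
    have h': "3 * h \<le> T" "3 * h \<le> 1 / (8 * L)" "h \<le> 1 / (12 * (slerp_const ^^ 3) M)"
      using h by (auto simp: h0_def)
    have curve: "near M h (\<gamma> s) (U s) (W s)" if s: "s \<in> {0..3*h}" for s
      unfolding M_def
    proof (rule near_rescale)
      have sT: "s \<in> {0..T}" using s h' by auto
      have "K * s ^ 4 \<le> L * s ^ 4" using L(2) s by (intro mult_right_mono) auto
      then show "near (100 * L ^ 5) s (\<gamma> s) (U s) (W s)"
        using near_curve[of "\<gamma> s" s L k c2 c3] taylor[OF sT] s sphere[OF sT] h' L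
        by (auto simp: U_def W_def proj_def N_def c1_eq)
    qed (use s L in auto)
    have "near M4 h (sider3 h (\<lambda>i. \<gamma> (real i * h)) s)
      (flat_sider3 (\<lambda>i. U (real i * h)) (s / h)) (flat_sider3 (\<lambda>i. W (real i * h)) (s / h))"
      unfolding M4_def
      by (rule near_sider3[OF curve M h(1) h'(3) s]) (use h in auto)
    moreover have "flat_sider3 (\<lambda>i. U (real i * h)) (s / h) = U s"
      "flat_sider3 (\<lambda>i. W (real i * h)) (s / h) = W s"
      unfolding U_def W_def by (rule flat_sider3_cubic; use h in simp)+
    ultimately have P: "near M4 h (sider3 h (\<lambda>i. \<gamma> (real i * h)) s) (U s) (W s)" by simp
    let ?P = "sider3 h (\<lambda>i. \<gamma> (real i * h)) s"
    \<comment> \<open>Curve and interpolant share the coordinates \<open>U s\<close>,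
      \<open>W s\<close>, so only their two remainders are left; the factor 3 of the result passes
      from chord to angle.\<close>
    have "norm (\<gamma> s - ?P) \<le> norm (\<gamma> s - (circ (U s) + W s)) + norm (?P - (circ (U s) + W s))"
      by (metis norm_minus_commute norm_triangle_sub norm_diff_triangle_ineq dist_norm dist_triangle2)
    also have "\<dots> \<le> M * h ^ 4 + M4 * h ^ 4"
      using curve[OF s] P unfolding near_def by (intro add_mono) auto
    finally have "norm (\<gamma> s - ?P) \<le> (M + M4) * h ^ 4" by (simp add: algebra_simps)
    then show ?thesis
      using sph_dist_le_chord[of "\<gamma> s" ?P] curve[OF s] P unfolding near_def by linarith
  qed
  have "\<forall>\<^sub>F h in at_right 0. 0 < h \<and> h < h0"
    using \<open>0 < h0\<close> by (auto simp: eventually_at_right_field)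
  then show ?thesis
    using main by (intro exI[of _ "3 * (M + M4)"]) (auto elim!: eventually_mono)
qed

end
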